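(* Let $(\Omega,\mathcal F,P)$ be a probability space and $\{A_n,n\ge1\}$ a stochastic process on it taking values in $\{1,2,3,\dots\}$. If $\{A_n,n\ge1\}$ is ergodic and $E(\log A_1)<\infty$, then \[ \lim_{n\to\infty}\frac{1}{n}\log Q_n=-\int_\Omega \log X\,dP\qquad P\text{-almost surely}. \]
   Context: For $\omega\in\Omega$, $X(\omega)=[A_1(\omega),A_2(\omega),\dots]=\cfrac{1}{A_1(\omega)+\cfrac{1}{A_2(\omega)+\cdots}}$ is the (convergent) infinite continued fraction, a random variable with values in $(0,1)$. For $n\ge1$, $P_n(\omega)/Q_n(\omega)=[A_1(\omega),\dots,A_n(\omega)]=\cfrac{1}{A_1(\omega)+\cfrac{1}{\ddots+\cfrac{1}{A_n(\omega)}}}$ with $P_n,Q_n$ coprime positive integers. A real-valued process $\{\xi_n,n\ge1\}$ is stationary if for all $n\in\mathbb N$ and all $B$ in the product Borel $\sigma$-algebra $\mathcal B(\mathbb R^{\mathbb N})$, $P((\xi_1,\xi_2,\dots)\in B)=P((\xi_{n+1},\xi_{n+2},\dots)\in B)$. A set $A\in\mathcal F$ is invariant for $\{\xi_n\}$ if there is $B\in\mathcal B(\mathbb R^{\mathbb N})$ with $A=\{\omega:(\xi_n(\omega),\xi_{n+1}(\omega),\dots)\in B\}$ for all $n\in\mathbb N$. A stationary process is ergodic if every invariant set has probability $0$ or $1$. *)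

theory Defs
  imports "HOL-Probability.Probability"
begin

text \<open>Sequences and processes are indexed from 1; their value at index 0 is never used.\<close>

fun cfrac :: "nat list \<Rightarrow> real" where
  "cfrac [] = 0"
| "cfrac (a # as) = 1 / (real a + cfrac as)"

definition cfrac_upto :: "(nat \<Rightarrow> nat) \<Rightarrow> nat \<Rightarrow> real" where
  "cfrac_upto a n = cfrac (map a [1..<Suc n])"

definition cfrac_inf :: "(nat \<Rightarrow> nat) \<Rightarrow> real" where
  "cfrac_inf a = lim (\<lambda>n. cfrac_upto a n)"

definition seq_borel :: "(nat \<Rightarrow> real) measure" where
  "seq_borel = (\<Pi>\<^sub>M k\<in>(UNIV :: nat set). (borel :: real measure))"

definition stationary_process :: "'a measure \<Rightarrow> (nat \<Rightarrow> 'a \<Rightarrow> real) \<Rightarrow> bool" where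
  "stationary_process M \<xi> \<longleftrightarrow>
     (\<forall>n\<ge>1. \<forall>B\<in>sets seq_borel.
        measure M {\<omega>\<in>space M. (\<lambda>k. \<xi> (1 + k) \<omega>) \<in> B} =
        measure M {\<omega>\<in>space M. (\<lambda>k. \<xi> (n + 1 + k) \<omega>) \<in> B})"

definition invariant_set :: "'a measure \<Rightarrow> (nat \<Rightarrow> 'a \<Rightarrow> real) \<Rightarrow> 'a set \<Rightarrow> bool" where
  "invariant_set M \<xi> S \<longleftrightarrow>
     S \<in> sets M \<and>
     (\<exists>B\<in>sets seq_borel. \<forall>n\<ge>1. S = {\<omega>\<in>space M. (\<lambda>k. \<xi> (n + k) \<omega>) \<in> B})"

definition ergodic_process :: "'a measure \<Rightarrow> (nat \<Rightarrow> 'a \<Rightarrow> real) \<Rightarrow> bool" where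
  "ergodic_process M \<xi> \<longleftrightarrow>
     stationary_process M \<xi> \<and>
     (\<forall>S. invariant_set M \<xi> S \<longrightarrow> measure M S = 0 \<or> measure M S = 1)"

end

theory Submission imports Defs begin

text \<open>Write \<open>X\<^sub>k\<close> for the continued fraction with digits \<open>A\<^sub>k, A\<^sub>k\<^sub>+\<^sub>1, \<dots>\<close>. Since
  \<open>1 / X\<^sub>k = A\<^sub>k + X\<^sub>k\<^sub>+\<^sub>1\<close>, the product \<open>1 / (X\<^sub>1 \<cdots> X\<^sub>n)\<close> satisfies the same recursion as the
  continuant \<open>Q\<^sub>n\<close> and lies between \<open>Q\<^sub>n\<close> and \<open>2 Q\<^sub>n\<close>. Hence \<open>ln Q\<^sub>n\<close> differs from the Birkhoff
  sum of \<open>- ln X\<close> under the shift by at most \<open>ln 2\<close>, and Birkhoff's theorem applies, because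
  \<open>0 \<le> - ln X \<le> ln 2 + ln A\<^sub>1\<close> is integrable.\<close>

section \<open>Birkhoff's theorem for ergodic systems\<close>

text \<open>Triviality is asked only of sets that are strictly invariant, at every point of the
  space. These are the sets whose preimages under the process satisfy
  \<open>invariant_set\<close>.\<close>

locale ergodic_system = prob_space +
  fixes T :: "'a \<Rightarrow> 'a"
  assumes T_measurable [measurable]: "T \<in> M \<rightarrow>\<^sub>M M"
    and distr_T: "distr M M T = M"
    and invariant_trivial:
      "\<And>B. B \<in> sets M \<Longrightarrow> (\<And>x. x \<in> space M \<Longrightarrow> T x \<in> B \<longleftrightarrow> x \<in> B) \<Longrightarrow> prob B = 0 \<or> prob B = 1"
begin

lemma integrable_comp_T:
  fixes f :: "'a \<Rightarrow> real"
  assumes "integrable M f"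
  shows "integrable M (\<lambda>x. f (T x))"
  using assms integrable_distr_eq[OF T_measurable, of f] distr_T by auto

lemma integral_comp_T:
  fixes f :: "'a \<Rightarrow> real"
  assumes "f \<in> borel_measurable M"
  shows "(\<integral>x. f (T x) \<partial>M) = (\<integral>x. f x \<partial>M)"
  using integral_distr[OF T_measurable assms] distr_T by simp

lemma T_space: "x \<in> space M \<Longrightarrow> T x \<in> space M"
  by (rule measurable_space[OF T_measurable])

text \<open>\<open>max_sum g n\<close> is the maximum of the Birkhoff sums of \<open>g\<close> of length \<open>0, \<dots>, n\<close>.\<close>

primrec max_sum :: "('a \<Rightarrow> real) \<Rightarrow> nat \<Rightarrow> 'a \<Rightarrow> real" where
  "max_sum g 0 x = 0"
| "max_sum g (Suc n) x = max 0 (g x + max_sum g n (T x))"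

lemma max_sum_nonneg: "0 \<le> max_sum g n x"
  by (cases n) auto

lemma max_sum_Suc_mono: "max_sum g n x \<le> max_sum g (Suc n) x"
proof (induction n arbitrary: x)
  case (Suc n)
  show ?case using Suc[of "T x"] by (simp only: max_sum.simps)
qed simp

lemma max_sum_mono: "m \<le> n \<Longrightarrow> max_sum g m x \<le> max_sum g n x"
  by (rule lift_Suc_mono_le[of "\<lambda>n. max_sum g n x", OF max_sum_Suc_mono])

lemma sum_le_max_sum: "(\<Sum>k<n. g ((T ^^ k) x)) \<le> max_sum g n x"
proof (induction n arbitrary: x)
  case (Suc n)
  have "(\<Sum>k<Suc n. g ((T ^^ k) x)) = g x + (\<Sum>k<n. g ((T ^^ k) (T x)))"
    by (simp add: sum.lessThan_Suc_shift funpow_swap1 del: sum.lessThan_Suc)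
  also have "\<dots> \<le> max_sum g (Suc n) x" using Suc[of "T x"] by simp
  finally show ?case .
qed simp

lemma integrable_max_sum:
  assumes "integrable M g"
  shows "integrable M (max_sum g n)"
proof (induction n)
  case 0
  have "max_sum g 0 = (\<lambda>_. 0)" by auto
  then show ?case by simp
next
  case (Suc n)
  have "max_sum g (Suc n) = (\<lambda>x. max 0 (g x + max_sum g n (T x)))" by auto
  then show ?case using integrable_comp_T[OF Suc] assms by simp
qed

text \<open>The set where the maxima are unbounded is invariant. If it had full measure, then
  \<open>max_sum g (Suc n) - max_sum g n \<circ> T\<close>, which has nonnegative integral, would converge to \<open>g\<close>.\<close>

lemma AE_max_sum_bounded:
  assumes g: "integrable M g" and neg: "(\<integral>x. g x \<partial>M) < 0"
  shows "AE x in M. \<exists>K. \<forall>n. max_sum g n x \<le> K"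
proof -
  note [measurable] = borel_measurable_integrable[OF integrable_max_sum[OF g]]
  \<comment> \<open>Natural bounds make \<open>E\<close> a countable combination of measurable sets;
    \<open>unbdd\<close> trades them for real bounds, which can be shifted by
    \<open>g x\<close>.\<close>
  define E where "E = {x \<in> space M. \<forall>K::nat. \<exists>n. max_sum g n x > real K}"
  have E[measurable]: "E \<in> sets M" unfolding E_def by measurable
  have unbdd: "(\<forall>K::nat. \<exists>n. max_sum g n x > real K) \<longleftrightarrow> (\<forall>K::real. \<exists>n. max_sum g n x > K)" for x
    by (meson le_less_trans real_arch_simple)
  have inv: "T x \<in> E \<longleftrightarrow> x \<in> E" if x: "x \<in> space M" for x
  proof -
    have "(\<forall>K::real. \<exists>n. max_sum g n x > K)" if *: "\<forall>K::real. \<exists>n. max_sum g n (T x) > K"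
    proof
      fix K :: real
      obtain n where "max_sum g n (T x) > K - g x" using * by blast
      then have "max_sum g (Suc n) x > K" by simp
      then show "\<exists>n. max_sum g n x > K" by blast
    qed
    moreover have "(\<forall>K::real. \<exists>n. max_sum g n (T x) > K)" if *: "\<forall>K::real. \<exists>n. max_sum g n x > K"
    proof
      fix K :: real
      \<comment> \<open>The \<open>0\<close> in the threshold excludes both \<open>n = 0\<close> and
        an outer maximum attained at \<open>0\<close>, so the branch through \<open>T x\<close> must
        be large.\<close>
      obtain n where n: "max_sum g n x > max 0 (K + g x)" using * by blast
      then obtain m where "n = Suc m" by (cases n) auto
      with n have "max_sum g m (T x) > K" by (auto simp: max_def split: if_splits)
      then show "\<exists>n. max_sum g n (T x) > K" by blast
    qed
    ultimately show ?thesis using x T_space[OF x] by (auto simp: E_def unbdd)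
  qed
  have "prob E \<noteq> 1"
  proof
    assume "prob E = 1"
    then have AE_E: "AE x in M. x \<in> E" by (simp add: AE_in_set_eq_1)
    define h where "h n x = max_sum g (Suc n) x - max_sum g n (T x)" for n x
    \<comment> \<open>Subtract \<open>max_sum g n (T x)\<close> inside the maximum of the recursion.
      Hence \<open>h n x = g x\<close> once the maximum at \<open>T x\<close> exceeds
      \<open>- g x\<close>, and by monotonicity this persists.\<close>
    have h: "h n x = max (- max_sum g n (T x)) (g x)" for n x by (simp add: h_def max_def)
    have lim: "(\<lambda>n. h n x) \<longlonglongrightarrow> g x" if xE: "x \<in> E" for x
    proof -
      have x: "x \<in> space M" using xE by (simp add: E_def)
      then have "T x \<in> E" using xE inv by blast
      then obtain N where N: "max_sum g N (T x) > - g x" by (auto simp: E_def unbdd)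
      have "h n x = g x" if "n \<ge> N" for n
        using N max_sum_mono[OF that, of g "T x"] by (simp add: h)
      then have "\<forall>\<^sub>F n in sequentially. h n x = g x" by (auto simp: eventually_sequentially)
      then show ?thesis by (rule tendsto_eventually)
    qed
    \<comment> \<open>\<open>T\<close> preserves the measure, so this is the integral of
      \<open>max_sum g (Suc n) - max_sum g n\<close>, a nonnegative function.\<close>
    have hint: "0 \<le> (\<integral>x. h n x \<partial>M)" for n
    proof -
      have "(\<integral>x. h n x \<partial>M) = (\<integral>x. max_sum g (Suc n) x \<partial>M) - (\<integral>x. max_sum g n (T x) \<partial>M)"
        unfolding h_def
        by (rule Bochner_Integration.integral_diff[OF integrable_max_sum[OF g]
              integrable_comp_T[OF integrable_max_sum[OF g]]])
      also have "\<dots> = (\<integral>x. max_sum g (Suc n) x \<partial>M) - (\<integral>x. max_sum g n x \<partial>M)"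
        by (subst integral_comp_T) auto
      also have "\<dots> \<ge> 0"
        using integral_mono[OF integrable_max_sum[OF g, of n] integrable_max_sum[OF g, of "Suc n"]
            max_sum_Suc_mono] by simp
      finally show ?thesis .
    qed
    have "(\<lambda>n. \<integral>x. h n x \<partial>M) \<longlonglongrightarrow> (\<integral>x. g x \<partial>M)"
    proof (rule integral_dominated_convergence[where w = "\<lambda>x. \<bar>g x\<bar>"])
      show "g \<in> borel_measurable M" using g by auto
      show "h n \<in> borel_measurable M" for n
        using g unfolding h_def[abs_def] by measurable
      show "integrable M (\<lambda>x. \<bar>g x\<bar>)" using g by auto
      show "AE x in M. (\<lambda>n. h n x) \<longlonglongrightarrow> g x" using AE_E lim by auto
      \<comment> \<open>As the maxima are nonnegative, \<open>h n x\<close> lies between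
        \<open>g x\<close> and \<open>max 0 (g x)\<close>.\<close>
      show "AE x in M. norm (h n x) \<le> \<bar>g x\<bar>" for n
      proof (rule AE_I2)
        fix x show "norm (h n x) \<le> \<bar>g x\<bar>"
          using max_sum_nonneg[of g n "T x"] by (auto simp: h max_def)
      qed
    qed
    then have "0 \<le> (\<integral>x. g x \<partial>M)" by (rule LIMSEQ_le_const) (use hint in auto)
    with neg show False by simp
  qed
  with invariant_trivial[OF E inv] have "prob E = 0" by blast
  then have "AE x in M. x \<notin> E" using E by (simp add: prob_eq_0)
  then show ?thesis
    by (rule AE_mp) (auto intro!: AE_I2 simp: E_def not_less)
qed

text \<open>Pick \<open>d\<close> strictly between the integral and \<open>c\<close>. Then
  \<open>f - d\<close> has negative integral, so its sums are bounded by some \<open>K\<close>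
  depending on the point, and \<open>K + n * d < n * c\<close> as soon as
  \<open>n > K / (c - d)\<close>.\<close>

lemma AE_eventually_average_le:
  assumes f: "integrable M f" and c: "(\<integral>x. f x \<partial>M) < c"
  shows "AE x in M. \<forall>\<^sub>F n in sequentially. (\<Sum>k<n. f ((T ^^ k) x)) / real n < c"
proof -
  obtain d where d: "(\<integral>x. f x \<partial>M) < d" "d < c" using c dense by blast
  have "AE x in M. \<exists>K. \<forall>n. max_sum (\<lambda>x. f x - d) n x \<le> K"
    by (rule AE_max_sum_bounded) (use f d in \<open>auto simp: prob_space\<close>)
  then show ?thesis
  proof (rule AE_mp, intro AE_I2 impI)
    fix x assume "\<exists>K. \<forall>n. max_sum (\<lambda>x. f x - d) n x \<le> K"
    then obtain K where K: "\<And>n. max_sum (\<lambda>x. f x - d) n x \<le> K" by blast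
    have *: "(\<Sum>k<n. f ((T ^^ k) x)) \<le> K + real n * d" for n
      using order_trans[OF sum_le_max_sum K, of n] by (simp add: sum_subtractf)
    have "\<forall>\<^sub>F n in sequentially. real n > K / (c - d)"
      using filterlim_real_sequentially by (simp add: filterlim_at_top_dense)
    then show "\<forall>\<^sub>F n in sequentially. (\<Sum>k<n. f ((T ^^ k) x)) / real n < c"
      using eventually_gt_at_top[of 0]
    proof eventually_elim
      case (elim n)
      then have "K < real n * (c - d)" using d by (simp add: pos_divide_less_eq)
      with *[of n] have "(\<Sum>k<n. f ((T ^^ k) x)) < c * real n" by (simp add: algebra_simps)
      then show ?case using elim by (simp add: pos_divide_less_eq)
    qed
  qed
qed

text \<open>The one-sided estimate for \<open>f\<close> and for \<open>- f\<close> squeezes the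
  averages. Taking only the tolerances \<open>1 / (m + 1)\<close> keeps the union of exceptional
  null sets countable.\<close>

theorem birkhoff:
  assumes f: "integrable M f"
  shows "AE x in M. (\<lambda>n. (\<Sum>k<n. f ((T ^^ k) x)) / real n) \<longlonglongrightarrow> (\<integral>x. f x \<partial>M)"
proof -
  let ?I = "\<integral>x. f x \<partial>M"
  have up: "AE x in M. \<forall>m. \<forall>\<^sub>F n in sequentially.
      (\<Sum>k<n. f ((T ^^ k) x)) / real n < ?I + inverse (real (Suc m))"
    unfolding AE_all_countable by (intro allI AE_eventually_average_le f) simp
  have lo: "AE x in M. \<forall>m. \<forall>\<^sub>F n in sequentially.
      (\<Sum>k<n. - f ((T ^^ k) x)) / real n < - ?I + inverse (real (Suc m))"
    unfolding AE_all_countable by (intro allI AE_eventually_average_le) (use f in auto)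
  from up lo show ?thesis
  proof eventually_elim
    case (elim x)
    show ?case
    proof (rule LIMSEQ_I)
      fix r :: real assume "0 < r"
      then obtain m where m: "inverse (real (Suc m)) < r" using reals_Archimedean by blast
      have "\<forall>\<^sub>F n in sequentially. norm ((\<Sum>k<n. f ((T ^^ k) x)) / real n - ?I) < r"
        using elim(1)[rule_format, of m] elim(2)[rule_format, of m]
        by eventually_elim (use m in \<open>auto simp: sum_negf\<close>)
      then show "\<exists>no. \<forall>n\<ge>no. norm ((\<Sum>k<n. f ((T ^^ k) x)) / real n - ?I) < r"
        by (simp add: eventually_sequentially)
    qed
  qed
qed

end

section \<open>Continued fractions\<close>

lemma cfrac_upto_0: "cfrac_upto a 0 = 0"
  by (simp add: cfrac_upto_def)

text \<open>Peeling off the first digit leaves a continued fraction of the shifted sequence, which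
  is why the inductions below generalise over \<open>a\<close>.\<close>

lemma cfrac_upto_Suc: "cfrac_upto a (Suc n) = 1 / (real (a 1) + cfrac_upto (\<lambda>i. a (Suc i)) n)"
proof -
  have "map a [1..<Suc (Suc n)] = a 1 # map (\<lambda>i. a (Suc i)) [1..<Suc n]"
    by (subst upt_conv_Cons) (auto simp: map_Suc_upt[symmetric] simp del: upt_Suc)
  then show ?thesis by (simp add: cfrac_upto_def del: upt_Suc)
qed

lemma cfrac_upto_bounds:
  assumes "\<forall>i\<ge>1. a i \<ge> 1"
  shows "0 \<le> cfrac_upto a n \<and> cfrac_upto a n \<le> 1"
  using assms
proof (induction n arbitrary: a)
  case (Suc n)
  have "0 \<le> cfrac_upto (\<lambda>i. a (Suc i)) n" using Suc by simp
  moreover have "real (a 1) \<ge> 1" using Suc.prems[rule_format, of 1] by simp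
  ultimately show ?case by (simp add: cfrac_upto_Suc)
qed (simp add: cfrac_upto_0)

text \<open>Two digits are peeled off at a time: one map \<open>x\<close> to
  \<open>1 / (u + x)\<close> has slope -1 at \<open>x = 0\<close> when \<open>u = 1\<close>, but the
  composite of two contracts by a factor of at least 4.\<close>

lemma cfrac_upto_dist:
  assumes "\<forall>i\<ge>1. a i \<ge> 1" "m \<ge> 2 * k" "n \<ge> 2 * k"
  shows "\<bar>cfrac_upto a m - cfrac_upto a n\<bar> \<le> (1 / 4) ^ k"
  using assms
proof (induction k arbitrary: a m n)
  case 0
  then show ?case using cfrac_upto_bounds[of a m] cfrac_upto_bounds[of a n] by (auto simp: abs_le_iff)
next
  case (Suc k)
  let ?b = "\<lambda>i. a (Suc (Suc i))"
  obtain m' where m: "m = Suc (Suc m')" using Suc.prems(2) by (cases m; cases "m - 1") auto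
  obtain n' where n: "n = Suc (Suc n')" using Suc.prems(3) by (cases n; cases "n - 1") auto
  define s where "s = cfrac_upto ?b m'"
  define t where "t = cfrac_upto ?b n'"
  define u where "u = real (a 1)"
  define v where "v = real (a 2)"
  have st: "0 \<le> s" "0 \<le> t"
    using cfrac_upto_bounds[of ?b] Suc.prems(1) by (auto simp: s_def t_def)
  have uv: "u \<ge> 1" "v \<ge> 1" using Suc.prems(1)[rule_format, of 1] Suc.prems(1)[rule_format, of 2] by (auto simp: u_def v_def)
  have IH: "\<bar>s - t\<bar> \<le> (1 / 4) ^ k" unfolding s_def t_def
    by (rule Suc.IH) (use Suc.prems m n in auto)
  \<comment> \<open>The two factors of the denominator in the difference below are each at least 2,
    whence the 1/4.\<close>
  have pos: "u * (v + r) + 1 \<ge> 2" if "r \<ge> 0" for r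
    using mult_mono[of 1 u 1 "v + r"] uv that by simp
  have frac: "1 / (u + 1 / (v + r)) = (v + r) / (u * (v + r) + 1)" if "r \<ge> 0" for r
    using uv that by (simp add: field_simps)
  have "(v + s) / (u * (v + s) + 1) - (v + t) / (u * (v + t) + 1)
      = (s - t) / ((u * (v + s) + 1) * (u * (v + t) + 1))"
    using pos[OF st(1)] pos[OF st(2)] by (simp add: diff_frac_eq) (simp add: algebra_simps)
  moreover have "4 \<le> (u * (v + s) + 1) * (u * (v + t) + 1)"
    using mult_mono[OF pos[OF st(1)] pos[OF st(2)]] pos[OF st(1)] by simp
  then have "\<bar>s - t\<bar> / ((u * (v + s) + 1) * (u * (v + t) + 1)) \<le> \<bar>s - t\<bar> / 4"
    by (intro divide_left_mono) auto
  ultimately have "\<bar>1 / (u + 1 / (v + s)) - 1 / (u + 1 / (v + t))\<bar> \<le> \<bar>s - t\<bar> / 4"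
    using pos[OF st(1)] pos[OF st(2)] by (simp only: frac st abs_divide abs_mult)
  also have "\<dots> \<le> (1 / 4) ^ Suc k" using IH by simp
  finally show ?case
    by (simp add: m n cfrac_upto_Suc s_def t_def u_def v_def numeral_2_eq_2)
qed

text \<open>The contraction makes the convergents Cauchy, so the \<open>lim\<close> in
  \<open>cfrac_inf\<close> is a genuine limit.\<close>

lemma cfrac_upto_tendsto:
  assumes "\<forall>i\<ge>1. a i \<ge> 1"
  shows "cfrac_upto a \<longlonglongrightarrow> cfrac_inf a"
proof -
  have "Cauchy (cfrac_upto a)"
  proof (rule CauchyI)
    fix e :: real assume "0 < e"
    then obtain k where k: "(1 / 4) ^ k < e" using real_arch_pow_inv[of e "1/4"] by auto
    have "norm (cfrac_upto a m - cfrac_upto a n) < e" if "m \<ge> 2 * k" "n \<ge> 2 * k" for m n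
      using cfrac_upto_dist[OF assms that] k by simp
    then show "\<exists>N. \<forall>m\<ge>N. \<forall>n\<ge>N. norm (cfrac_upto a m - cfrac_upto a n) < e" by blast
  qed
  then show ?thesis
    by (simp add: Cauchy_convergent_iff convergent_LIMSEQ_iff cfrac_inf_def)
qed

lemma cfrac_inf_bounds:
  assumes "\<forall>i\<ge>1. a i \<ge> 1"
  shows "0 \<le> cfrac_inf a" "cfrac_inf a \<le> 1"
  using cfrac_upto_bounds[OF assms] cfrac_upto_tendsto[OF assms]
  by (auto intro: LIMSEQ_le_const LIMSEQ_le_const2)

lemma cfrac_inf_rec:
  assumes "\<forall>i\<ge>1. a i \<ge> 1"
  shows "cfrac_inf a = 1 / (real (a 1) + cfrac_inf (\<lambda>i. a (Suc i)))"
proof (rule LIMSEQ_unique)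
  show "(\<lambda>n. cfrac_upto a (Suc n)) \<longlonglongrightarrow> cfrac_inf a"
    by (rule LIMSEQ_Suc[OF cfrac_upto_tendsto[OF assms]])
  have "0 \<le> cfrac_inf (\<lambda>i. a (Suc i))" by (rule cfrac_inf_bounds) (use assms in auto)
  moreover have "real (a 1) \<ge> 1" using assms[rule_format, of 1] by simp
  ultimately have "real (a 1) + cfrac_inf (\<lambda>i. a (Suc i)) \<noteq> 0" by linarith
  then show "(\<lambda>n. cfrac_upto a (Suc n)) \<longlonglongrightarrow> 1 / (real (a 1) + cfrac_inf (\<lambda>i. a (Suc i)))"
    unfolding cfrac_upto_Suc by (intro tendsto_intros cfrac_upto_tendsto) (use assms in auto)
qed

text \<open>Limits preserve only weak inequalities; strictness comes from the recursion, whose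
  denominator is finite and positive.\<close>

lemma cfrac_inf_pos:
  assumes "\<forall>i\<ge>1. a i \<ge> 1"
  shows "0 < cfrac_inf a"
proof -
  have "0 \<le> cfrac_inf (\<lambda>i. a (Suc i))" by (rule cfrac_inf_bounds) (use assms in auto)
  moreover have "real (a 1) \<ge> 1" using assms[rule_format, of 1] by simp
  ultimately show ?thesis by (subst cfrac_inf_rec[OF assms]) auto
qed

text \<open>Allows digit functions that differ at index 0 to be identified, as happens when
  \<open>i - 1\<close> truncates there.\<close>

lemma cfrac_inf_cong:
  assumes "\<And>i. i \<ge> 1 \<Longrightarrow> a i = b i"
  shows "cfrac_inf a = cfrac_inf b"
proof -
  have "map a [1..<Suc n] = map b [1..<Suc n]" for n using assms by auto
  then show ?thesis unfolding cfrac_inf_def cfrac_upto_def by (simp only:)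
qed

section \<open>Continuants and the denominators of the convergents\<close>

text \<open>Euler's continuant. It is unfolded from the first digit rather than the last, so that it
  fits the shift and \<open>cfrac_upto_Suc\<close>.\<close>

fun continuant :: "(nat \<Rightarrow> nat) \<Rightarrow> nat \<Rightarrow> nat" where
  "continuant a 0 = 1"
| "continuant a (Suc 0) = a 1"
| "continuant a (Suc (Suc n)) =
     a 1 * continuant (\<lambda>i. a (Suc i)) (Suc n) + continuant (\<lambda>i. a (Suc (Suc i))) n"

lemma continuant_pos:
  assumes "\<forall>i\<ge>1. a i \<ge> 1"
  shows "continuant a n > 0"
  using assms by (induction a n rule: continuant.induct) (auto simp: Suc_le_eq)

text \<open>A step of Euclid's algorithm: adding a multiple of one argument to the other leaves the
  gcd unchanged. The pair is the numerator and denominator of a convergent.\<close>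

lemma coprime_continuant: "coprime (continuant (\<lambda>i. a (Suc i)) n) (continuant a (Suc n))"
proof (induction n arbitrary: a)
  case (Suc n)
  have "gcd (continuant (\<lambda>i. a (Suc i)) (Suc n)) (continuant (\<lambda>i. a (Suc (Suc i))) n) = 1"
    using Suc[of "\<lambda>i. a (Suc i)"] by (metis coprime_imp_gcd_eq_1 gcd.commute)
  then show ?case by (simp only: continuant.simps coprime_iff_gcd_eq_1 gcd_add_mult)
qed simp

lemma cfrac_upto_continuant:
  assumes "\<forall>i\<ge>1. a i \<ge> 1"
  shows "cfrac_upto a (Suc n) = real (continuant (\<lambda>i. a (Suc i)) n) / real (continuant a (Suc n))"
  using assms
proof (induction n arbitrary: a)
  case 0
  then show ?case by (simp add: cfrac_upto_Suc cfrac_upto_0)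
next
  case (Suc n)
  have "continuant (\<lambda>i. a (Suc i)) (Suc n) > 0" by (rule continuant_pos) (use Suc.prems in auto)
  moreover have "cfrac_upto (\<lambda>i. a (Suc i)) (Suc n) =
      real (continuant (\<lambda>i. a (Suc (Suc i))) n) / real (continuant (\<lambda>i. a (Suc i)) (Suc n))"
    by (rule Suc.IH) (use Suc.prems in auto)
  ultimately show ?case
    unfolding cfrac_upto_Suc[of a "Suc n"] continuant.simps(3) by (simp add: add_divide_eq_iff)
qed

text \<open>\<open>Q\<close> is given only through a reduced fraction; uniqueness of lowest terms
  identifies it with the continuant.\<close>

lemma continuant_unique:
  fixes p q :: nat
  assumes "\<forall>i\<ge>1. a i \<ge> 1" and "q > 0" "coprime p q"
    and "real p / real q = cfrac_upto a (Suc n)"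
  shows "q = continuant a (Suc n)"
proof -
  let ?p = "continuant (\<lambda>i. a (Suc i)) n" and ?q = "continuant a (Suc n)"
  have "?q > 0" by (rule continuant_pos[OF assms(1)])
  with assms have "real p * real ?q = real ?p * real q"
    by (simp add: cfrac_upto_continuant[OF assms(1)] field_simps)
  then have "p * ?q = ?p * q" by (metis of_nat_eq_iff of_nat_mult)
  then show ?thesis
    using coprime_crossproduct_nat[of p q ?p ?q] assms(3) coprime_continuant[of a n] by auto
qed

text \<open>Both sides obey one recursion with nonnegative coefficients, so bounds propagate from
  the initial values. For \<open>n = 1\<close> the product is \<open>a 1 + x\<close> with
  \<open>0 \<le> x \<le> 1 \<le> a 1\<close>, which is the source of the factor 2.\<close>

lemma prod_cfrac_inf_bounds:
  assumes "\<forall>i\<ge>1. a i \<ge> 1"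
  shows "real (continuant a n) \<le> (\<Prod>k<n. 1 / cfrac_inf (\<lambda>i. a (i + k))) \<and>
    (\<Prod>k<n. 1 / cfrac_inf (\<lambda>i. a (i + k))) \<le> 2 * real (continuant a n)"
  using assms
proof (induction a n rule: continuant.induct)
  case (2 a)
  let ?x = "cfrac_inf (\<lambda>i. a (Suc i))"
  have "0 \<le> ?x" "?x \<le> 1" by (rule cfrac_inf_bounds; use 2 in simp)+
  moreover have "real (a 1) \<ge> 1" using 2[rule_format, of 1] by simp
  moreover have "1 / cfrac_inf a = real (a 1) + ?x" using cfrac_inf_rec[OF 2] by simp
  ultimately show ?case by simp
next
  case (3 a n)
  let ?R = "\<lambda>a n. \<Prod>k<n. 1 / cfrac_inf (\<lambda>i. a (i + k))"
  let ?b = "\<lambda>i. a (Suc i)" and ?c = "\<lambda>i. a (Suc (Suc i))"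
  have shift: "?R a (Suc n) = 1 / cfrac_inf a * ?R (\<lambda>i. a (Suc i)) n" for a n
    by (simp add: prod.lessThan_Suc_shift del: prod.lessThan_Suc)
  have xb: "0 < cfrac_inf ?b" by (rule cfrac_inf_pos) (use 3 in auto)
  have "1 / cfrac_inf a = real (a 1) + cfrac_inf ?b" using cfrac_inf_rec[OF 3(3)] by simp
  then have "?R a (Suc (Suc n)) = real (a 1) * ?R ?b (Suc n) + cfrac_inf ?b * ?R ?b (Suc n)"
    by (simp only: shift[of a] distrib_right)
  \<comment> \<open>The factor cancels the leading reciprocal of the product.\<close>
  also have "cfrac_inf ?b * ?R ?b (Suc n) = ?R ?c n" using xb by (simp only: shift[of ?b]) simp
  finally have eq: "?R a (Suc (Suc n)) = real (a 1) * ?R ?b (Suc n) + ?R ?c n" .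
  have b: "real (continuant ?b (Suc n)) \<le> ?R ?b (Suc n)" "?R ?b (Suc n) \<le> 2 * real (continuant ?b (Suc n))"
    using 3(1) 3(3) by auto
  have c: "real (continuant ?c n) \<le> ?R ?c n" "?R ?c n \<le> 2 * real (continuant ?c n)"
    using 3(2) 3(3) by auto
  show ?case unfolding eq continuant.simps
    using mult_left_mono[OF b(1), of "real (a 1)"] mult_left_mono[OF b(2), of "real (a 1)"] c
    by (simp add: algebra_simps)
qed simp

text \<open>The factor 2 becomes an additive error independent of \<open>n\<close>, which disappears
  after division by \<open>n\<close>.\<close>

lemma ln_continuant_bounds:
  assumes "\<forall>i\<ge>1. a i \<ge> 1"
  shows "\<bar>ln (real (continuant a n)) - (\<Sum>k<n. - ln (cfrac_inf (\<lambda>i. a (i + k))))\<bar> \<le> ln 2"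
proof -
  let ?R = "\<Prod>k<n. 1 / cfrac_inf (\<lambda>i. a (i + k))"
  have pos: "0 < cfrac_inf (\<lambda>i. a (i + k))" for k by (rule cfrac_inf_pos) (use assms in auto)
  have "ln ?R = (\<Sum>k<n. ln (1 / cfrac_inf (\<lambda>i. a (i + k))))"
    using pos by (intro ln_prod) (auto simp: less_imp_neq[symmetric])
  also have "\<dots> = (\<Sum>k<n. - ln (cfrac_inf (\<lambda>i. a (i + k))))"
    using less_imp_neq[OF pos, symmetric] by (simp add: ln_div)
  finally have lnR: "ln ?R = \<dots>" .
  have q: "real (continuant a n) > 0" using continuant_pos[OF assms] by simp
  have "ln (real (continuant a n)) \<le> ln ?R"
    using prod_cfrac_inf_bounds[OF assms, of n] q by (intro ln_mono) auto
  moreover have "ln ?R \<le> ln (2 * real (continuant a n))"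
    using prod_cfrac_inf_bounds[OF assms, of n] q by (intro ln_mono) auto
  moreover have "ln (2 * real (continuant a n)) = ln 2 + ln (real (continuant a n))"
    using q by (simp add: ln_mult)
  ultimately show ?thesis unfolding lnR by linarith
qed

section \<open>The shift on the space of sequences\<close>

lemma space_seq_borel: "space seq_borel = UNIV"
  by (simp add: seq_borel_def space_PiM)

lemma measurable_seq_borelI:
  assumes "\<And>k. (\<lambda>x. f x k) \<in> borel_measurable M"
  shows "f \<in> M \<rightarrow>\<^sub>M seq_borel"
  unfolding seq_borel_def by (rule measurable_PiM_single') (use assms in auto)

lemma measurable_seq_borel_component: "(\<lambda>x. x k) \<in> borel_measurable seq_borel"
  unfolding seq_borel_def by (rule measurable_component_singleton) simp

lemma funpow_shift: "((\<lambda>x k. x (Suc k)) ^^ n) x = (\<lambda>k. x (k + n))"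
  by (induction n arbitrary: x) (auto simp: funpow_swap1)

text \<open>The original space carries no transformation, so the process is replaced by its law on
  sequence space, where the shift acts. Stationarity gives invariance of the law, and invariant sets
  pull back to invariant events.\<close>

lemma ergodic_process_shift:
  assumes "prob_space M" and meas: "\<And>n. n \<ge> 1 \<Longrightarrow> \<xi> n \<in> borel_measurable M"
    and erg: "ergodic_process M \<xi>"
  shows "ergodic_system (distr M seq_borel (\<lambda>\<omega> k. \<xi> (1 + k) \<omega>)) (\<lambda>x k. x (Suc k))"
proof -
  interpret prob_space M by fact
  define Y where "Y n \<omega> = (\<lambda>k. \<xi> (n + k) \<omega>)" for n \<omega>
  have Y: "Y n \<in> M \<rightarrow>\<^sub>M seq_borel" if "n \<ge> 1" for n
    by (rule measurable_seq_borelI) (use that meas in \<open>simp add: Y_def\<close>)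
  note Y1 = Y[OF order_refl]
  define N where "N = distr M seq_borel (Y 1)"
  define T where "T = (\<lambda>(x::nat \<Rightarrow> real) k. x (Suc k))"
  have T0: "T \<in> seq_borel \<rightarrow>\<^sub>M seq_borel"
    unfolding T_def by (rule measurable_seq_borelI) (rule measurable_seq_borel_component)
  have TY: "T (Y n \<omega>) = Y (Suc n) \<omega>" for n \<omega> by (auto simp: T_def Y_def)
  have setsN: "sets N = sets seq_borel" by (simp add: N_def)
  have "T \<in> N \<rightarrow>\<^sub>M N" using T0 by (simp add: N_def)
  \<comment> \<open>Stationarity with \<open>n = 1\<close> is what measure preservation amounts to,
    as \<open>T\<close> sends \<open>Y 1\<close> to \<open>Y 2\<close>.\<close>
  have stat: "measure M {\<omega>\<in>space M. Y 1 \<omega> \<in> B} = measure M {\<omega>\<in>space M. Y 2 \<omega> \<in> B}"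
    if "B \<in> sets seq_borel" for B
  proof -
    have "\<forall>n\<ge>1. \<forall>B\<in>sets seq_borel. measure M {\<omega>\<in>space M. Y 1 \<omega> \<in> B} =
        measure M {\<omega>\<in>space M. Y (n + 1) \<omega> \<in> B}"
      using erg unfolding ergodic_process_def stationary_process_def Y_def by blast
    from this[rule_format, of 1, OF _ that] show ?thesis by (simp add: numeral_2_eq_2)
  qed
  have "distr N N T = distr M seq_borel (T \<circ> Y 1)"
    unfolding N_def using T0 Y1 by (subst distr_distr) (auto intro!: distr_cong)
  also have "T \<circ> Y 1 = Y 2" by (auto simp: TY numeral_2_eq_2)
  also have "distr M seq_borel (Y 2) = distr M seq_borel (Y 1)"
  proof (rule measure_eqI)
    fix B assume "B \<in> sets (distr M seq_borel (Y 2))"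
    then have B: "B \<in> sets seq_borel" by simp
    show "emeasure (distr M seq_borel (Y 2)) B = emeasure (distr M seq_borel (Y 1)) B"
      using stat[OF B] B Y[of 2] Y1
      by (simp add: emeasure_distr emeasure_eq_measure vimage_def Int_def conj_commute)
  qed simp
  finally have dT: "distr N N T = N" by (simp add: N_def)
  have triv: "measure N B = 0 \<or> measure N B = 1"
    if B: "B \<in> sets N" and inv: "\<And>x. x \<in> space N \<Longrightarrow> T x \<in> B \<longleftrightarrow> x \<in> B" for B
  proof -
    have Bs: "B \<in> sets seq_borel" using B setsN by simp
    define S where "S = {\<omega>\<in>space M. Y 1 \<omega> \<in> B}"
    \<comment> \<open>Since \<open>T\<close> sends \<open>Y n\<close> to \<open>Y (Suc n)\<close>,
      strict invariance of \<open>B\<close> makes the event the same for every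
      \<open>n\<close>.\<close>
    have Sn: "S = {\<omega>\<in>space M. Y n \<omega> \<in> B}" if "n \<ge> 1" for n
      using that
    proof (induction n rule: dec_induct)
      case (step n)
      then show ?case using inv[of "Y n _"] by (simp add: TY N_def space_seq_borel)
    qed (simp add: S_def)
    have "S \<in> sets M" using measurable_sets[OF Y1 Bs] by (simp add: S_def vimage_def Int_def conj_commute)
    then have "invariant_set M \<xi> S"
      unfolding invariant_set_def using Bs Sn by (auto simp: Y_def)
    then have "measure M S = 0 \<or> measure M S = 1" using erg by (auto simp: ergodic_process_def)
    moreover have "measure N B = measure M S"
      unfolding N_def S_def using Y1 Bs by (simp add: measure_distr vimage_def Int_def conj_commute)
    ultimately show ?thesis by simp
  qed
  have "prob_space N" unfolding N_def using Y1 by (rule prob_space_distr)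
  then interpret N: prob_space N .
  have "ergodic_system N T"
    by unfold_locales (fact \<open>T \<in> N \<rightarrow>\<^sub>M N\<close>, fact dT, fact triv)
  then show ?thesis by (simp add: N_def T_def Y_def[abs_def])
qed

section \<open>Transfer to sequence space and conclusion\<close>

theorem theorem3:
  fixes M :: "'a measure"
    and A :: "nat \<Rightarrow> 'a \<Rightarrow> nat"
    and P Q :: "nat \<Rightarrow> 'a \<Rightarrow> nat"
    and X :: "'a \<Rightarrow> real"
  assumes "prob_space M"
    and "\<And>n. n \<ge> 1 \<Longrightarrow> A n \<in> measurable M (count_space UNIV)"
    and "\<And>n \<omega>. n \<ge> 1 \<Longrightarrow> \<omega> \<in> space M \<Longrightarrow> A n \<omega> \<ge> 1"
    and "\<And>\<omega>. \<omega> \<in> space M \<Longrightarrow> X \<omega> = cfrac_inf (\<lambda>n. A n \<omega>)"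
    and "\<And>n \<omega>. n \<ge> 1 \<Longrightarrow> \<omega> \<in> space M \<Longrightarrow>
           P n \<omega> > 0 \<and> Q n \<omega> > 0 \<and> coprime (P n \<omega>) (Q n \<omega>) \<and>
           real (P n \<omega>) / real (Q n \<omega>) = cfrac_upto (\<lambda>i. A i \<omega>) n"
    and "ergodic_process M (\<lambda>n \<omega>. real (A n \<omega>))"
    and "(\<integral>\<^sup>+ \<omega>. ennreal (ln (real (A 1 \<omega>))) \<partial>M) < \<infinity>"
  shows "AE \<omega> in M.
           (\<lambda>n. 1 / real n * ln (real (Q n \<omega>)))
             \<longlonglongrightarrow> - (\<integral>\<omega>'. ln (X \<omega>') \<partial>M)"
proof -
  interpret prob_space M by fact
  define Y where "Y \<omega> = (\<lambda>k. real (A (1 + k) \<omega>))" for \<omega>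
  have A_borel: "(\<lambda>\<omega>. real (A n \<omega>)) \<in> borel_measurable M" if "n \<ge> 1" for n
    using assms(2)[OF that] by (rule measurable_compose) simp
  have Y: "Y \<in> M \<rightarrow>\<^sub>M seq_borel"
    by (rule measurable_seq_borelI) (use A_borel in \<open>simp add: Y_def\<close>)
  define N where "N = distr M seq_borel Y"
  define T where "T = (\<lambda>(x::nat \<Rightarrow> real) k. x (Suc k))"
  interpret N: ergodic_system N T
    unfolding N_def T_def Y_def[abs_def] by (rule ergodic_process_shift) (use assms(1,6) A_borel in auto)
  \<comment> \<open>Sequence positions start at 0 and digits at 1, hence \<open>i - 1\<close>;
    \<open>nat\<close> of the floor recovers the integer digits exactly on values of
    \<open>Y\<close>.\<close>
  define F where "F x = - ln (cfrac_inf (\<lambda>i. nat \<lfloor>x (i - 1)\<rfloor>))" for x :: "nat \<Rightarrow> real"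
  \<comment> \<open>The offset \<open>j\<close> is for the induction: peeling off a digit turns
    \<open>j\<close> into \<open>Suc j\<close>.\<close>
  have cfrac_upto_meas: "(\<lambda>x. cfrac_upto (\<lambda>i. nat \<lfloor>x (i - 1 + j)\<rfloor>) n) \<in> borel_measurable seq_borel" for j n
  proof (induction n arbitrary: j)
    case (Suc n)
    have "(\<lambda>x. cfrac_upto (\<lambda>i. nat \<lfloor>x (i - 1 + Suc j)\<rfloor>) n) \<in> borel_measurable seq_borel" by (rule Suc)
    moreover have "cfrac_upto (\<lambda>i. nat \<lfloor>x (Suc i - 1 + j)\<rfloor>) n = cfrac_upto (\<lambda>i. nat \<lfloor>x (i - 1 + Suc j)\<rfloor>) n"
      for x :: "nat \<Rightarrow> real"
      unfolding cfrac_upto_def by (rule arg_cong[where f = cfrac]) (auto simp del: upt_Suc)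
    moreover have "(\<lambda>x. real (nat \<lfloor>x j\<rfloor>)) \<in> borel_measurable seq_borel"
      by (rule measurable_compose[OF measurable_seq_borel_component]) measurable
    ultimately show ?case by (simp add: cfrac_upto_Suc)
  qed (simp add: cfrac_upto_0)
  \<comment> \<open>Measurability of a pointwise \<open>lim\<close> needs no convergence, so
    sequences that are not digit sequences do no harm.\<close>
  have F: "F \<in> borel_measurable seq_borel"
    unfolding F_def[abs_def] cfrac_inf_def
    using cfrac_upto_meas[of 0] by (auto intro!: borel_measurable_uminus borel_measurable_ln borel_measurable_lim_metric)
  have FT: "F ((T ^^ k) (Y \<omega>)) = - ln (cfrac_inf (\<lambda>i. A (i + k) \<omega>))" for k \<omega>
  proof -
    have "cfrac_inf (\<lambda>i. nat \<lfloor>(T ^^ k) (Y \<omega>) (i - 1)\<rfloor>) = cfrac_inf (\<lambda>i. A (i + k) \<omega>)"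
      by (rule cfrac_inf_cong) (simp add: T_def funpow_shift Y_def)
    then show ?thesis by (simp add: F_def)
  qed
  have FY: "F (Y \<omega>) = - ln (X \<omega>)" if "\<omega> \<in> space M" for \<omega>
    using FT[of 0 \<omega>] assms(4)[OF that] by simp
  have FY_bounds: "0 \<le> F (Y \<omega>) \<and> F (Y \<omega>) \<le> ln 2 + ln (real (A 1 \<omega>))" if w: "\<omega> \<in> space M" for \<omega>
  proof -
    let ?a = "\<lambda>i. A i \<omega>"
    let ?x = "cfrac_inf (\<lambda>i. ?a (Suc i))"
    have a: "\<forall>i\<ge>1. ?a i \<ge> 1" using assms(3) w by blast
    have "0 \<le> ?x" "?x \<le> 1" by (rule cfrac_inf_bounds; use a in simp)+
    moreover have a1: "real (?a 1) \<ge> 1" using a[rule_format, of 1] by simp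
    ultimately have "1 \<le> real (?a 1) + ?x" "real (?a 1) + ?x \<le> 2 * real (?a 1)" by linarith+
    moreover have "F (Y \<omega>) = ln (real (?a 1) + ?x)"
      using FY[OF w] assms(4)[OF w] cfrac_inf_rec[OF a] calculation by (simp add: ln_div)
    moreover have "ln (2 * real (?a 1)) = ln 2 + ln (real (?a 1))" using a1 by (simp add: ln_mult)
    ultimately show ?thesis by (metis ln_ge_zero ln_mono less_le_trans zero_less_one)
  qed
  \<comment> \<open>Digits are at least 1, so the logarithm is nonnegative and
    \<open>ennreal\<close> truncates nothing in the moment hypothesis.\<close>
  have "integrable M (\<lambda>\<omega>. ln (real (A 1 \<omega>)))"
  proof (rule integrableI_nonneg)
    show "(\<lambda>\<omega>. ln (real (A 1 \<omega>))) \<in> borel_measurable M" using A_borel[of 1] by simp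
    show "AE \<omega> in M. 0 \<le> ln (real (A 1 \<omega>))"
      using assms(3)[of 1] by (intro AE_I2 ln_ge_zero) auto
  qed (fact assms(7))
  then have "integrable M (\<lambda>\<omega>. ln 2 + ln (real (A 1 \<omega>)))" by simp
  then have "integrable M (\<lambda>\<omega>. F (Y \<omega>))"
    by (rule Bochner_Integration.integrable_bound)
       (use measurable_compose[OF Y F] FY_bounds in \<open>force intro!: AE_I2\<close>)+
  then have "integrable N F" unfolding N_def using Y F by (simp add: integrable_distr_eq)
  from N.birkhoff[OF this]
  have "AE \<omega> in M. (\<lambda>n. (\<Sum>k<n. F ((T ^^ k) (Y \<omega>))) / real n) \<longlonglongrightarrow> (\<integral>x. F x \<partial>N)"
    by (subst (asm) N_def) (rule AE_distrD[OF Y])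
  moreover have "(\<integral>x. F x \<partial>N) = - (\<integral>\<omega>. ln (X \<omega>) \<partial>M)"
  proof -
    have "(\<integral>x. F x \<partial>N) = (\<integral>\<omega>. F (Y \<omega>) \<partial>M)" unfolding N_def by (rule integral_distr[OF Y F])
    also have "\<dots> = (\<integral>\<omega>. - ln (X \<omega>) \<partial>M)"
      by (rule Bochner_Integration.integral_cong) (auto simp: FY)
    finally show ?thesis by simp
  qed
  ultimately have "AE \<omega> in M. (\<lambda>n. (\<Sum>k<n. F ((T ^^ k) (Y \<omega>))) / real n)
      \<longlonglongrightarrow> - (\<integral>\<omega>. ln (X \<omega>) \<partial>M)" by simp
  then show ?thesis
  proof (rule AE_mp, intro AE_I2 impI)
    fix \<omega> assume w: "\<omega> \<in> space M"
      and lim: "(\<lambda>n. (\<Sum>k<n. F ((T ^^ k) (Y \<omega>))) / real n) \<longlonglongrightarrow> - (\<integral>\<omega>. ln (X \<omega>) \<partial>M)"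
    let ?S = "\<lambda>n. \<Sum>k<n. F ((T ^^ k) (Y \<omega>))"
    let ?a = "\<lambda>i. A i \<omega>"
    have a: "\<forall>i\<ge>1. ?a i \<ge> 1" using assms(3) w by blast
    have Q: "Q n \<omega> = continuant ?a n" if n: "n \<ge> 1" for n
    proof -
      obtain m where "n = Suc m" using n by (cases n) auto
      then show ?thesis using assms(5)[OF n w] continuant_unique[OF a, of "Q n \<omega>" "P n \<omega>" m] by auto
    qed
    \<comment> \<open>The numerator stays within \<open>ln 2\<close> of zero, so the averages of
      \<open>?S\<close> and of \<open>ln Q\<close> have the same limit.\<close>
    have "(\<lambda>n. (ln (real (Q n \<omega>)) - ?S n) / real n) \<longlonglongrightarrow> 0"
    proof (rule Lim_null_comparison)
      show "(\<lambda>n. ln 2 / real n) \<longlonglongrightarrow> 0" by (rule lim_const_over_n)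
      show "\<forall>\<^sub>F n in sequentially. norm ((ln (real (Q n \<omega>)) - ?S n) / real n) \<le> ln 2 / real n"
        using eventually_ge_at_top[of 1]
      proof eventually_elim
        case (elim n)
        have "\<bar>ln (real (Q n \<omega>)) - ?S n\<bar> \<le> ln 2"
          unfolding Q[OF elim] FT by (rule ln_continuant_bounds[OF a])
        then show ?case by (simp add: abs_divide divide_right_mono)
      qed
    qed
    from tendsto_add[OF this lim]
    show "(\<lambda>n. 1 / real n * ln (real (Q n \<omega>))) \<longlonglongrightarrow> - (\<integral>\<omega>'. ln (X \<omega>') \<partial>M)"
      by (simp add: diff_divide_distrib)
  qed
qed

end
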